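(* Let $k\ge 1$, let $Q_k(z)\in\mathbb{C}[z]$ be a polynomial of degree $k$, let $\gamma\in\mathbb{C}$ with $\gamma\neq 0$, and let $\sqrt{\gamma}$ be a fixed square root of $\gamma$. Let $p_0(z)=1$, let $p_1(z)\in\mathbb{C}[z]$ be a polynomial of degree $k$, and define polynomials $p_n(z)$ by $$p_{n+1}(z)=Q_k(z)\,p_n(z)+\gamma\,p_{n-1}(z),\qquad n\ge 1 .$$ Put $p(z)=p_1(z)-Q_k(z)$. Then the limiting set of roots of the sequence $(p_n)$ is a subset of $$\{\,z\in\mathbb{C} : Q_k(z)=2i\sqrt{\gamma}\,\sin\theta \text{ for some } \theta\in\mathbb{R}\,\}\ \cup\ \Big\{\,z\in\mathbb{C} : p(z)\ne 0 \text{ and } Q_k(z)=\frac{\gamma}{p(z)}-p(z)\,\Big\}.$$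
   Context: The limiting set of roots of a sequence of polynomials $(p_n)$ is the maximal set $S\subset\mathbb{C}$ with the following property: for every $s\in S$ and every $\epsilon>0$ there exists $N$ such that for all $n\ge N$ the polynomial $p_n$ has at least one root in the $\epsilon$-neighbourhood of $s$. (Equivalently, $S$ is the set of all points $s\in\mathbb{C}$ having this property.) *)

theory Defs
  imports Complex_Main "HOL-Computational_Algebra.Polynomial"
begin

definition approximated_by_roots :: "(nat \<Rightarrow> complex poly) \<Rightarrow> complex set \<Rightarrow> bool" where
  "approximated_by_roots p S \<longleftrightarrow>
     (\<forall>s\<in>S. \<forall>\<epsilon>>0. \<exists>N. \<forall>n\<ge>N. \<exists>z. poly (p n) z = 0 \<and> dist z s < \<epsilon>)"

definition limiting_root_set :: "(nat \<Rightarrow> complex poly) \<Rightarrow> complex set" where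
  "limiting_root_set p = (GREATEST S. approximated_by_roots p S)"

text \<open>The property is pointwise, so the greatest such set exists.\<close>

lemma limiting_root_set_eq:
  "limiting_root_set p =
     {s. \<forall>\<epsilon>>0. \<exists>N. \<forall>n\<ge>N. \<exists>z. poly (p n) z = 0 \<and> dist z s < \<epsilon>}"
  unfolding limiting_root_set_def
  by (rule Greatest_equality) (auto simp: approximated_by_roots_def)

end

theory Submission imports Defs begin

text \<open>
  Let \<open>l\<close> and \<open>-\<gamma>/l\<close> be the characteristic roots of the recurrence at \<open>z\<close>, with \<open>l\<close> a dominant one.
  Then \<open>(l + \<gamma>/l) p\<^sub>n = (l + p) l^n - (p - \<gamma>/l) (-\<gamma>/l)^n\<close>. At a point off the curve the two roots have
  different moduli, so \<open>l\<close> is continuous there; if moreover \<open>l + p \<noteq> 0\<close>, the first term wins uniformly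
  on a neighbourhood, which is thus free of roots of \<open>p\<^sub>n\<close> for all large \<open>n\<close>. In the remaining case
  \<open>p = -l\<close> and \<open>Q = l - \<gamma>/l = \<gamma>/p - p\<close>.
\<close>

text \<open>The two roots have product \<open>- \<gamma>\<close>, so their moduli multiply to
  \<open>norm \<gamma>\<close> and they cannot both be smaller than its square root. If the root
  \<open>a\<close> from the quadratic formula is too small, its partner
  \<open>- \<gamma> / a\<close> is taken.\<close>

lemma exists_dominant_root:
  fixes q \<gamma> :: complex
  assumes "\<gamma> \<noteq> 0"
  shows "\<exists>l. l^2 = q * l + \<gamma> \<and> norm \<gamma> \<le> (norm l)^2"
proof -
  define a where "a = (q + csqrt (q^2 + 4 * \<gamma>)) / 2"
  have "2 * a - q = csqrt (q^2 + 4 * \<gamma>)"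
    by (simp add: a_def field_simps)
  hence "(2 * a - q)^2 = q^2 + 4 * \<gamma>"
    by simp
  hence "4 * a^2 = 4 * (q * a + \<gamma>)"
    by (simp add: power2_eq_square algebra_simps)
  hence a: "a^2 = q * a + \<gamma>"
    by (subst (asm) mult_cancel_left) simp
  hence a0: "a \<noteq> 0" using assms by auto
  show ?thesis
  proof (cases "norm \<gamma> \<le> (norm a)^2")
    case True
    with a show ?thesis by blast
  next
    case False
    define b where "b = - \<gamma> / a"
    have ab: "a * b = - \<gamma>" using a0 by (simp add: b_def)
    have "a * (a + b - q) = 0" using a ab by (simp add: power2_eq_square algebra_simps)
    hence "q = a + b" using a0 by simp
    hence "b^2 = q * b + \<gamma>" using ab by (simp add: power2_eq_square algebra_simps)
    moreover have "norm \<gamma> \<le> (norm b)^2"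
    proof -
      have eq: "norm \<gamma> = norm a * norm b"
        using arg_cong[OF ab, of norm] by (simp add: norm_mult)
      hence "norm a * norm a < norm a * norm b"
        using False by (simp add: power2_eq_square)
      hence "norm a \<le> norm b" by (simp add: mult_less_cancel_left)
      thus ?thesis unfolding eq power2_eq_square by (rule mult_right_mono) simp
    qed
    ultimately show ?thesis by blast
  qed
qed

text \<open>Here \<open>l\<close> lies on the circle through \<open>g\<close>, so
  \<open>l = g * cis t\<close>. The other root is \<open>- \<gamma> / l = - g * cis (- t)\<close>,
  and \<open>q\<close> is the sum of the two.\<close>

lemma quadratic_root_equal_moduli:
  fixes q \<gamma> g l :: complex
  assumes "\<gamma> \<noteq> 0" "g^2 = \<gamma>" "l^2 = q * l + \<gamma>" "(norm l)^2 = norm \<gamma>"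
  shows "\<exists>t::real. q = 2 * \<i> * g * complex_of_real (sin t)"
proof -
  have g0: "g \<noteq> 0" and l0: "l \<noteq> 0" using assms by auto
  have "norm \<gamma> = (norm g)^2" using assms(2) by (metis norm_power)
  hence "norm l = norm g" using assms(4) by (simp add: power2_eq_iff_nonneg)
  hence n1: "norm (l / g) = 1" using g0 by (simp add: norm_divide)
  define t where "t = Arg (l / g)"
  have lt: "l = g * cis t"
  proof -
    have "cis t = l / g" unfolding t_def using n1 l0 g0
      by (simp add: cis_Arg sgn_eq)
    thus ?thesis using g0 by simp
  qed
  have "l * (q - g * (cis t - cis (- t))) = 0"
  proof -
    have c: "cis t * cis (- t) = 1" by (simp add: cis_mult)
    have "l * (g * (cis t - cis (- t))) = l * l - g * g * (cis t * cis (- t))"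
      unfolding lt by (simp add: algebra_simps)
    also have "\<dots> = l * q" using assms(2,3) by (simp add: c power2_eq_square algebra_simps)
    finally show ?thesis by (simp add: algebra_simps)
  qed
  hence "q = g * (cis t - cis (- t))" using l0 by simp
  also have "cis t - cis (- t) = 2 * \<i> * complex_of_real (sin t)"
    by (simp add: complex_eq_iff)
  finally show ?thesis by (auto intro!: exI[of _ t])
qed

text \<open>Both sides obey the same second-order recurrence and agree at 0 and 1. Keeping the
  factor \<open>a - b\<close> on the left avoids division.\<close>

lemma binary_recurrence_closed_form:
  fixes u :: "nat \<Rightarrow> 'a::comm_ring_1"
  assumes "u 0 = 1" "u 1 = a + b + p"
    and "\<And>n. n \<ge> 1 \<Longrightarrow> u (n + 1) = (a + b) * u n - a * b * u (n - 1)"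
  shows "(a - b) * u n = (a + p) * a^n - (b + p) * b^n"
proof (induction n rule: less_induct)
  case (less n)
  consider "n = 0" | "n = 1" | m where "n = m + 2"
    by (metis One_nat_def Suc_1 add_2_eq_Suc' not0_implies_Suc)
  thus ?case
  proof cases
    case 3
    have "(a - b) * u n = (a + b) * ((a - b) * u (m + 1)) - a * b * ((a - b) * u m)"
    proof -
      have "u n = (a + b) * u (m + 1) - a * b * u m"
        using assms(3)[of "m + 1"] 3 by simp
      thus ?thesis by (simp only:) (simp add: algebra_simps)
    qed
    also have "\<dots> = (a + b) * ((a + p) * a^(m+1) - (b + p) * b^(m+1))
                   - a * b * ((a + p) * a^m - (b + p) * b^m)"
      using less.IH[of m] less.IH[of "m + 1"] 3 by simp
    also have "\<dots> = (a + p) * a^n - (b + p) * b^n"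
      using 3 by (simp add: algebra_simps power2_eq_square)
    finally show ?thesis .
  qed (use assms(1,2) in \<open>simp_all add: algebra_simps\<close>)
qed

text \<open>\<open>L\<close> is an arbitrary pointwise choice of a dominant root. Strict dominance
  at the limit keeps it away from the smaller root \<open>m\<close>, so it must follow
  \<open>l\<close>.\<close>

lemma dominant_root_tendsto:
  fixes q L :: "'a \<Rightarrow> complex" and \<gamma> l q0 :: complex
  assumes q: "(q \<longlongrightarrow> q0) F"
    and L: "\<And>z. (L z)^2 = q z * L z + \<gamma>" "\<And>z. norm \<gamma> \<le> (norm (L z))^2"
    and l: "l^2 = q0 * l + \<gamma>" "norm \<gamma> < (norm l)^2" and "\<gamma> \<noteq> 0"
  shows "(L \<longlongrightarrow> l) F"
proof -
  \<comment> \<open>The radius \<open>g\<close> separates the roots: every \<open>L z\<close> lies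
    on or outside that circle, while \<open>m\<close> lies strictly inside, at distance
    \<open>c\<close> from it.\<close>
  define g where "g = sqrt (norm \<gamma>)"
  define m where "m = - \<gamma> / l"
  have g0: "g > 0" and gg: "g^2 = norm \<gamma>" using assms by (auto simp: g_def)
  have l0: "l \<noteq> 0" using l \<open>\<gamma> \<noteq> 0\<close> by auto
  have gl: "g < norm l" using l(2) by (simp add: g_def real_less_lsqrt)
  have gL: "g \<le> norm (L z)" for z using L(2)[of z] by (simp add: g_def real_le_lsqrt)
  have lm: "l * m = - \<gamma>" using l0 by (simp add: m_def)
  have "l * (l + m - q0) = 0" using l(1) lm by (simp add: power2_eq_square algebra_simps)
  hence q0: "q0 = l + m" using l0 by simp
  have mg: "norm m < g"
  proof -
    have "norm m * norm l = g * g" using lm gg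
      by (metis mult.commute norm_minus_cancel norm_mult power2_eq_square)
    also have "\<dots> < g * norm l" using gl g0 by simp
    finally show ?thesis using g0 gl by (simp add: mult_less_cancel_right)
  qed
  define c where "c = g - norm m"
  have c0: "c > 0" using mg by (simp add: c_def)
  have bound: "norm (L z - l) \<le> norm (q z - q0) * (norm (q z) + g) / c" for z
  proof -
    have Lz0: "norm (L z) > 0" using g0 gL[of z] by linarith
    \<comment> \<open>The left side is the characteristic polynomial for \<open>q0\<close> at
      \<open>L z\<close>; since \<open>L z\<close> is a root of the one for \<open>q z\<close>, only
      the difference of the linear terms remains.\<close>
    have "(L z - l) * (L z - m) = (q z - q0) * L z"
      using L(1)[of z] lm unfolding q0 by (simp add: power2_eq_square algebra_simps)
    hence 1: "norm (L z - l) * norm (L z - m) = norm (q z - q0) * norm (L z)"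
      by (metis norm_mult)
    have 2: "c \<le> norm (L z - m)"
      using gL[of z] norm_triangle_ineq2[of "L z" m] by (simp add: c_def)
    \<comment> \<open>An a priori bound on \<open>L z\<close>: one factor \<open>g\<close> is
      replaced by \<open>norm (L z)\<close>, which is then cancelled.\<close>
    have "norm (L z) * norm (L z) \<le> norm (q z) * norm (L z) + g * g"
      using L(1)[of z] gg norm_triangle_ineq[of "q z * L z" \<gamma>]
      by (metis norm_mult power2_eq_square)
    also have "\<dots> \<le> (norm (q z) + g) * norm (L z)"
      using gL[of z] g0 by (simp add: algebra_simps)
    finally have 3: "norm (L z) \<le> norm (q z) + g" using Lz0 by simp
    have "norm (L z - l) * c \<le> norm (L z - l) * norm (L z - m)"
      using 2 by (rule mult_left_mono) simp
    also have "\<dots> \<le> norm (q z - q0) * (norm (q z) + g)"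
      unfolding 1 using 3 by (rule mult_left_mono) simp
    finally show ?thesis using c0 by (simp add: field_simps)
  qed
  have "((\<lambda>z. norm (q z - q0) * (norm (q z) + g) / c) \<longlongrightarrow> norm (q0 - q0) * (norm q0 + g) / c) F"
    using c0 by (intro tendsto_intros q) auto
  hence "((\<lambda>z. norm (q z - q0) * (norm (q z) + g) / c) \<longlongrightarrow> 0) F" by simp
  hence "((\<lambda>z. L z - l) \<longlongrightarrow> 0) F"
    proof (rule metric_tendsto_imp_tendsto, intro always_eventually allI)
    show "dist (L z - l) 0 \<le> dist (norm (q z - q0) * (norm (q z) + g) / c) 0" for z
      using order_trans[OF bound[of z] abs_ge_self] by (simp only: dist_norm diff_0_right real_norm_def)
  qed
  thus ?thesis by (simp add: LIM_zero_iff)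
qed

theorem theorem1:
  fixes k :: nat and Q p :: "complex poly" and \<gamma> sqrt_\<gamma> :: complex
    and P :: "nat \<Rightarrow> complex poly"
  assumes "k \<ge> 1"
    and "degree Q = k"
    and "\<gamma> \<noteq> 0"
    and "sqrt_\<gamma> ^ 2 = \<gamma>"
    and "P 0 = 1"
    and "degree (P 1) = k"
    and "\<forall>n\<ge>1. P (n + 1) = Q * P n + smult \<gamma> (P (n - 1))"
    and "p = P 1 - Q"
  shows "limiting_root_set P \<subseteq>
           {z. \<exists>\<theta>::real. poly Q z = 2 * \<i> * sqrt_\<gamma> * complex_of_real (sin \<theta>)} \<union>
           {z. poly p z \<noteq> 0 \<and> poly Q z = \<gamma> / poly p z - poly p z}"
proof (rule subsetI, rule ccontr)
  fix s
  assume "s \<in> limiting_root_set P"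
  hence near: "\<And>e. e > 0 \<Longrightarrow> \<exists>N. \<forall>n\<ge>N. \<exists>z. poly (P n) z = 0 \<and> dist z s < e"
    by (simp add: limiting_root_set_eq)
  assume notin: "s \<notin> {z. \<exists>\<theta>::real. poly Q z = 2 * \<i> * sqrt_\<gamma> * complex_of_real (sin \<theta>)} \<union>
           {z. poly p z \<noteq> 0 \<and> poly Q z = \<gamma> / poly p z - poly p z}"
  obtain L where L: "\<And>z. (L z)^2 = poly Q z * L z + \<gamma>" "\<And>z. norm \<gamma> \<le> (norm (L z))^2"
  proof -
    have "\<forall>z. \<exists>l. l^2 = poly Q z * l + \<gamma> \<and> norm \<gamma> \<le> (norm l)^2"
      using exists_dominant_root[OF \<open>\<gamma> \<noteq> 0\<close>] by blast
    thus ?thesis using that by metis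
  qed
  have L0: "L z \<noteq> 0" for z using L(1)[of z] \<open>\<gamma> \<noteq> 0\<close> by auto
  have Q: "poly Q z = L z - \<gamma> / L z" for z
    using L(1)[of z] L0[of z] by (simp add: field_simps power2_eq_square)
  \<comment> \<open>Equality would put \<open>s\<close> on the sine curve.\<close>
  have gap: "norm \<gamma> < (norm (L s))^2"
    using quadratic_root_equal_moduli[OF \<open>\<gamma> \<noteq> 0\<close> \<open>sqrt_\<gamma> ^ 2 = \<gamma>\<close> L(1)[of s]] L(2)[of s] notin
    by fastforce
  have Lp0: "L s + poly p s \<noteq> 0"
  proof
    assume "L s + poly p s = 0"
    hence "L s = - poly p s" by (simp add: eq_neg_iff_add_eq_0)
    thus False using notin L0[of s] Q[of s] by simp
  qed
  \<comment> \<open>The filter is \<open>nhds s\<close>, not the punctured one, because the root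
    near \<open>s\<close> may be \<open>s\<close> itself.\<close>
  have limL: "(L \<longlongrightarrow> L s) (nhds s)"
  proof (rule dominant_root_tendsto[OF _ L L(1)[of s] gap \<open>\<gamma> \<noteq> 0\<close>])
    show "(poly Q \<longlongrightarrow> poly Q s) (nhds s)"
      using poly_isCont[of s Q] by (simp add: tendsto_at_iff_tendsto_nhds isCont_def)
  qed
  have limp: "(poly p \<longlongrightarrow> poly p s) (nhds s)"
    using poly_isCont[of s p] by (simp add: tendsto_at_iff_tendsto_nhds isCont_def)
  \<comment> \<open>\<open>c\<close>, \<open>M\<close> and, below, \<open>r\<close> are strict
    bounds at \<open>s\<close> for the dominant coefficient, the other coefficient and the ratio of
    the two roots, so by continuity they persist on a ball around \<open>s\<close>.\<close>
  define c where "c = norm (L s + poly p s) / 2"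
  define M where "M = norm (poly p s - \<gamma> / L s) + 1"
  have c0: "c > 0" using Lp0 by (simp add: c_def)
  have "norm (- (\<gamma> / L s) / L s) < 1"
    using gap L0[of s] by (simp add: norm_divide norm_mult power2_eq_square divide_simps)
  then obtain r where r: "norm (- (\<gamma> / L s) / L s) < r" "r < 1"
    using dense by blast
  have "0 \<le> norm (- (\<gamma> / L s) / L s)" by (rule norm_ge_zero)
  with r(1) have r0: "0 < r" by linarith
  have "\<forall>\<^sub>F z in nhds s. c < norm (L z + poly p z)"
    by (rule order_tendstoD(1)[of _ "norm (L s + poly p s)"])
       (use Lp0 in \<open>auto simp: c_def intro!: tendsto_intros limL limp\<close>)
  moreover have "\<forall>\<^sub>F z in nhds s. norm (poly p z - \<gamma> / L z) < M"
    by (rule order_tendstoD(2)[of _ "norm (poly p s - \<gamma> / L s)"])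
       (use L0 in \<open>auto simp: M_def intro!: tendsto_intros limL limp\<close>)
  moreover have "\<forall>\<^sub>F z in nhds s. norm (- (\<gamma> / L z) / L z) < r"
    by (rule order_tendstoD(2)[OF _ r(1)]) (use L0 in \<open>auto intro!: tendsto_intros limL\<close>)
  ultimately have "\<forall>\<^sub>F z in nhds s. c < norm (L z + poly p z) \<and>
      norm (poly p z - \<gamma> / L z) < M \<and> norm (- (\<gamma> / L z) / L z) < r"
    by eventually_elim blast
  then obtain d where d: "d > 0" "\<And>z. dist z s < d \<Longrightarrow> c < norm (L z + poly p z) \<and>
      norm (poly p z - \<gamma> / L z) < M \<and> norm (- (\<gamma> / L z) / L z) < r"
    unfolding eventually_nhds_metric by blast
  obtain N where N: "\<And>n. n \<ge> N \<Longrightarrow> \<exists>z. poly (P n) z = 0 \<and> dist z s < d"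
    using near[OF d(1)] by blast
  have "(\<lambda>n. M * r^n) \<longlonglongrightarrow> M * 0"
    using r0 r(2) by (intro tendsto_intros LIMSEQ_realpow_zero) auto
  hence "\<forall>\<^sub>F n in sequentially. M * r^n < c"
    using c0 by (intro order_tendstoD(2)) auto
  \<comment> \<open>A single index suffices: late enough for a root of \<open>P n\<close> in the
    ball, and for the minor term to fall below \<open>c\<close>.\<close>
  then obtain n where n: "n \<ge> N" "M * r^n < c"
    unfolding eventually_sequentially by (meson nle_le)
  obtain z where z: "poly (P n) z = 0" "dist z s < d" using N[OF n(1)] by blast
  define b where "b = - (\<gamma> / L z)"
  have "(L z - b) * poly (P n) z = (L z + poly p z) * L z ^ n - (b + poly p z) * b ^ n"
  proof (rule binary_recurrence_closed_form)
    show "poly (P 1) z = L z + b + poly p z"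
      using Q[of z] \<open>p = P 1 - Q\<close> by (simp add: b_def)
    show "poly (P (m + 1)) z = (L z + b) * poly (P m) z - L z * b * poly (P (m - 1)) z"
      if "m \<ge> 1" for m
      using assms(7) that Q[of z] L0[of z] by (simp add: b_def)
  qed (simp add: \<open>P 0 = 1\<close>)
  \<comment> \<open>At a root of \<open>P n\<close> the two terms of the closed form balance;
    dividing by \<open>L z ^ n\<close> leaves a left side of modulus above \<open>c\<close> and a
    right side of modulus at most \<open>M * r ^ n\<close>.\<close>
  hence "L z + poly p z = (b + poly p z) * (b / L z) ^ n"
    using z(1) L0[of z] by (simp add: field_simps)
  hence "norm (L z + poly p z) = norm (poly p z - \<gamma> / L z) * norm (- (\<gamma> / L z) / L z) ^ n"
    by (simp add: b_def norm_mult norm_power norm_divide)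
  also have "\<dots> \<le> M * r ^ n"
    using d(2)[OF z(2)] r0 by (intro mult_mono power_mono) (auto simp: M_def)
  finally show False using n(2) d(2)[OF z(2)] by simp
qed

end
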